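(* Let $\alpha,\beta$ be real numbers with $0<\alpha<\beta$. Then there is a constant $C$ (depending on $\alpha,\beta$ but independent of the solution, i.e. of the initial data and of $E(0)$) such that for every solution $u$ on $[0,\infty)$ of $$u''+|u'|^{\alpha}u'+|u|^{\beta}u=0,$$ the energy $E(t)=\frac12 u'(t)^2+\frac{1}{\beta+2}|u(t)|^{\beta+2}$ satisfies $$\forall t>0,\qquad E(t)\le C\max\left\{t^{-\frac{2}{\alpha}},\; t^{-\frac{(\alpha+1)(\beta+2)}{\beta-\alpha}}\right\}.$$
   Context: Solutions are real-valued functions $u\in C^2([0,\infty);\mathbb{R})$ satisfying the equation for all $t\ge 0$, with arbitrary initial data $(u(0),u'(0))\in\mathbb{R}^2$; the initial value problem for $t\ge0$ is well posed (standard). *)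

theory Defs
  imports "HOL-Analysis.Analysis"
begin

text \<open>
  The class \<open>C\<^sup>2([0,\<infinity>); \<real>)\<close>: only the values of \<open>u\<close>, \<open>u'\<close>, \<open>u''\<close> on \<open>[0,\<infinity>)\<close> matter, and the
  derivatives are taken within \<open>[0,\<infinity>)\<close>, that is, one-sided at \<open>0\<close>.  They are therefore determined
  there by \<open>u\<close>.
\<close>

definition C2_halfline :: "(real \<Rightarrow> real) \<Rightarrow> (real \<Rightarrow> real) \<Rightarrow> (real \<Rightarrow> real) \<Rightarrow> bool" where
  "C2_halfline u u' u'' \<longleftrightarrow>
     (\<forall>t\<ge>0. (u has_real_derivative u' t) (at t within {0..})) \<and>
     (\<forall>t\<ge>0. (u' has_real_derivative u'' t) (at t within {0..})) \<and>
     continuous_on {0..} u''"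

text \<open>
  The powers are real powers of nonnegative bases; \<open>0 powr a = 0\<close> is the intended value, as all the
  exponents that occur on \<open>\<bar>u\<bar>\<close> and \<open>\<bar>u'\<bar>\<close> are positive.
\<close>

definition is_solution ::
  "real \<Rightarrow> real \<Rightarrow> (real \<Rightarrow> real) \<Rightarrow> (real \<Rightarrow> real) \<Rightarrow> (real \<Rightarrow> real) \<Rightarrow> bool" where
  "is_solution \<alpha> \<beta> u u' u'' \<longleftrightarrow>
     C2_halfline u u' u'' \<and>
     (\<forall>t\<ge>0. u'' t + \<bar>u' t\<bar> powr \<alpha> * u' t + \<bar>u t\<bar> powr \<beta> * u t = 0)"

definition energy :: "real \<Rightarrow> (real \<Rightarrow> real) \<Rightarrow> (real \<Rightarrow> real) \<Rightarrow> real \<Rightarrow> real" where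
  "energy \<beta> u u' t = 1 / 2 * (u' t)\<^sup>2 + 1 / (\<beta> + 2) * \<bar>u t\<bar> powr (\<beta> + 2)"

end

theory Submission
  imports Defs
begin

text \<open>
  Along a solution \<open>E' = - \<bar>u'\<bar> powr (\<alpha> + 2)\<close>, so the energy decreases, but the dissipation
  degenerates where \<open>u' = 0\<close>.  The cross term \<open>u u'\<close> repairs this: \<open>(u u')'\<close> contains
  \<open>- \<bar>u\<bar> powr (\<beta> + 2)\<close>, hence controls the potential energy, at the price of the kinetic term
  \<open>u'\<^sup>2\<close> and of the damping term \<open>\<bar>u'\<bar> powr (\<alpha> + 1) * \<bar>u\<bar>\<close>.  On a time interval where the energy
  stays between \<open>e\<close> and \<open>2 e\<close>, both of these are at most a fraction of the gain \<open>(\<beta> + 2) e\<close> plus a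
  multiple \<open>K\<close> of the dissipation, and \<open>K\<close> is at most of the order of
  \<open>R e = e powr (- \<alpha>/2) + e powr (- q)\<close> with \<open>q = (\<beta> - \<alpha>) / ((\<alpha> + 1) (\<beta> + 2))\<close>: the first power
  comes from the kinetic term, the second from the damping term.  Thus \<open>u u' + K E\<close> decreases at
  rate at least \<open>\<beta> e\<close>, whereas its total change is at most of the order of
  \<open>e powr (1/2 + 1/(\<beta> + 2)) + K e\<close>, which is at most of the order of \<open>e * R e\<close>.  Hence the energy
  cannot take longer than a multiple of \<open>R e\<close> to fall from \<open>2 e\<close> to \<open>e\<close> (\<open>halving_time\<close>, where
  \<open>R\<close> is \<open>halving_bound\<close>).

  Since both exponents in \<open>R\<close> are negative, the times needed for the successive halvings that lead
  down to the level \<open>e\<close> are dominated by a geometric series, whatever the initial energy is.  This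
  gives \<open>t \<le> B * R (E t)\<close> with \<open>B\<close> independent of the solution (\<open>time_le_halving_bound\<close>).
  One of the two powers in \<open>R\<close> dominates, and inverting it gives the two alternatives of the maximum.
\<close>

section \<open>Powers and derivatives\<close>

lemma has_real_derivative_abs_powr:
  fixes x p :: real
  assumes "p > 1"
  shows "((\<lambda>x. \<bar>x\<bar> powr p) has_real_derivative p * \<bar>x\<bar> powr (p - 2) * x) (at x)"
proof -
  consider "x > 0" | "x < 0" | "x = 0" by linarith
  then show ?thesis
  proof cases
    case 1
    have "((\<lambda>x. x powr p) has_real_derivative p * x powr (p - 1)) (at x)"
      using 1 by (rule has_real_derivative_powr)
    moreover have "x powr (p - 1) = x powr (p - 2) * x"
      using 1 powr_mult_base[of x "p - 2"] by (simp add: mult.commute)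
    ultimately have "((\<lambda>x. x powr p) has_real_derivative p * \<bar>x\<bar> powr (p - 2) * x) (at x)"
      using 1 by (simp add: mult.assoc)
    then show ?thesis
      by (rule has_field_derivative_transform_within_open[where S = "{0<..}"]) (use 1 in auto)
  next
    case 2
    have "((\<lambda>x. (- x) powr p) has_real_derivative - (p * (- x) powr (p - 1))) (at x)"
      using 2 by (auto intro!: derivative_eq_intros)
    moreover have "(- x) powr (p - 1) = (- x) powr (p - 2) * (- x)"
      using 2 powr_mult_base[of "- x" "p - 2"] by (simp add: mult.commute)
    ultimately have "((\<lambda>x. (- x) powr p) has_real_derivative p * \<bar>x\<bar> powr (p - 2) * x) (at x)"
      using 2 by (simp add: mult.assoc)
    then show ?thesis
      by (rule has_field_derivative_transform_within_open[where S = "{..<0}"]) (use 2 in auto)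
  next
    case 3
    have "(\<lambda>h. \<bar>h\<bar> powr (p - 1)) \<midarrow>0\<rightarrow> (0::real)"
      using assms tendsto_powr'[OF tendsto_rabs[OF tendsto_ident_at[of "0::real" UNIV]]
          tendsto_const[of "p - 1"]] by simp
    moreover have "\<bar>\<bar>h\<bar> powr p / h\<bar> = \<bar>h\<bar> powr (p - 1)" for h :: real
      by (cases "h = 0") (simp_all add: powr_diff)
    ultimately have "(\<lambda>h. \<bar>\<bar>h\<bar> powr p / h\<bar>) \<midarrow>0\<rightarrow> (0::real)"
      by simp
    then have "(\<lambda>h. \<bar>h\<bar> powr p / h) \<midarrow>0\<rightarrow> (0::real)"
      by (rule tendsto_rabs_zero_cancel)
    then show ?thesis
      using 3 by (simp add: DERIV_def)
  qed
qed

lemma abs_powr_mult_square: "\<bar>x\<bar> powr a * x * x = \<bar>x\<bar> powr (a + 2)" for x a :: real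
  by (cases "x = 0") (simp_all add: powr_add power2_eq_square flip: abs_mult)

lemma increment_le_of_derivative_le:
  fixes f f' :: "real \<Rightarrow> real"
  assumes f: "\<And>t. t \<ge> 0 \<Longrightarrow> (f has_real_derivative f' t) (at t within {0..})"
    and "0 \<le> a" "a \<le> b" and le: "\<And>t. a \<le> t \<Longrightarrow> t \<le> b \<Longrightarrow> f' t \<le> c"
  shows "f b - f a \<le> c * (b - a)"
proof -
  have "\<exists>x\<in>{a..b}. f b - f a = (\<lambda>h. f' x * h) (b - a)"
  proof (rule mvt_very_simple[OF \<open>a \<le> b\<close>])
    fix x assume "a \<le> x" "x \<le> b"
    then have "(f has_real_derivative f' x) (at x within {a..b})"
      using f[of x] \<open>0 \<le> a\<close> by (auto intro: DERIV_subset)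
    then show "(f has_derivative (\<lambda>h. f' x * h)) (at x within {a..b})"
      by (simp add: has_field_derivative_def)
  qed
  then obtain x where "x \<in> {a..b}" "f b - f a = f' x * (b - a)" by auto
  then show ?thesis using le[of x] \<open>a \<le> b\<close> by (simp add: mult_right_mono)
qed

text \<open>
  A substitute for Young's inequality: below the threshold \<open>\<nu>\<close> the power \<open>a\<close> is at most its value
  there, above it the higher power \<open>b\<close> takes over.
\<close>

lemma powr_le_threshold:
  fixes x \<nu> a b :: real
  assumes "0 \<le> x" "0 < \<nu>" "0 \<le> a" "a \<le> b"
  shows "x powr a \<le> \<nu> powr a + \<nu> powr (a - b) * x powr b"
proof (cases "x \<le> \<nu>")
  case True
  then have "x powr a \<le> \<nu> powr a" using assms by (intro powr_mono2) auto
  then show ?thesis by (simp add: add_increasing2)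
next
  case False
  then have "x powr (a - b) \<le> \<nu> powr (a - b)" using assms by (intro powr_mono2') auto
  then have "x powr (a - b) * x powr b \<le> \<nu> powr (a - b) * x powr b" by (rule mult_right_mono) simp
  then have "x powr a \<le> \<nu> powr (a - b) * x powr b" using False assms by (simp flip: powr_add)
  then show ?thesis by (simp add: add_increasing)
qed

lemma powr_between_le_add:
  fixes x a b c :: real
  assumes "0 < x" "a \<le> c \<and> c \<le> b \<or> b \<le> c \<and> c \<le> a"
  shows "x powr c \<le> x powr a + x powr b"
proof -
  have "x powr c \<le> x powr a \<or> x powr c \<le> x powr b"
    using assms by (cases "x \<le> 1") (auto intro: powr_mono powr_mono')
  then show ?thesis
    by (smt (verit) powr_ge_zero)
qed

section \<open>The energy\<close>

context
  fixes \<alpha> \<beta> :: real and u u' u'' :: "real \<Rightarrow> real"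
  assumes \<alpha>: "0 < \<alpha>" and \<beta>: "0 < \<beta>" and sol: "is_solution \<alpha> \<beta> u u' u''"
begin

lemma solution_derivatives:
  assumes "t \<ge> 0"
  shows "(u has_real_derivative u' t) (at t within {0..})"
    and "(u' has_real_derivative u'' t) (at t within {0..})"
    and "u'' t = - (\<bar>u' t\<bar> powr \<alpha> * u' t) - \<bar>u t\<bar> powr \<beta> * u t"
  using sol assms unfolding is_solution_def C2_halfline_def by (auto simp: algebra_simps)

lemma energy_derivative:
  assumes "t \<ge> 0"
  shows "(energy \<beta> u u' has_real_derivative - (\<bar>u' t\<bar> powr (\<alpha> + 2))) (at t within {0..})"
proof -
  note d = solution_derivatives[OF assms]
  have pot: "((\<lambda>t. \<bar>u t\<bar> powr (\<beta> + 2)) has_real_derivative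
      (\<beta> + 2) * \<bar>u t\<bar> powr \<beta> * u t * u' t) (at t within {0..})"
    using DERIV_chain2[OF has_real_derivative_abs_powr[of "\<beta> + 2" "u t"] d(1)] \<beta> by simp
  have "(energy \<beta> u u' has_real_derivative
      1 / 2 * (2 * u' t * u'' t) + 1 / (\<beta> + 2) * ((\<beta> + 2) * \<bar>u t\<bar> powr \<beta> * u t * u' t))
      (at t within {0..})"
    unfolding energy_def[abs_def]
    by (intro DERIV_add DERIV_cmult pot) (auto intro!: derivative_eq_intros d(2))
  then have "(energy \<beta> u u' has_real_derivative
      u' t * u'' t + \<bar>u t\<bar> powr \<beta> * u t * u' t) (at t within {0..})"
    using \<beta> by (simp add: mult.assoc)
  moreover have "u' t * u'' t + \<bar>u t\<bar> powr \<beta> * u t * u' t = - (\<bar>u' t\<bar> powr \<alpha> * u' t * u' t)"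
    unfolding d(3) by (simp add: algebra_simps)
  ultimately show ?thesis by (simp add: abs_powr_mult_square)
qed

lemma cross_term_derivative:
  assumes "t \<ge> 0"
  shows "((\<lambda>t. u t * u' t) has_real_derivative
           (u' t)\<^sup>2 - \<bar>u' t\<bar> powr \<alpha> * u' t * u t - \<bar>u t\<bar> powr (\<beta> + 2)) (at t within {0..})"
proof -
  note d = solution_derivatives[OF assms]
  have "((\<lambda>t. u t * u' t) has_real_derivative u' t * u' t + u'' t * u t) (at t within {0..})"
    by (auto intro!: derivative_eq_intros d)
  moreover have "u' t * u' t + u'' t * u t =
      (u' t)\<^sup>2 - \<bar>u' t\<bar> powr \<alpha> * u' t * u t - \<bar>u t\<bar> powr \<beta> * u t * u t"
    unfolding d(3) by (simp add: algebra_simps power2_eq_square)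
  ultimately show ?thesis by (simp add: abs_powr_mult_square)
qed

lemma energy_antimono: "0 \<le> s \<Longrightarrow> s \<le> t \<Longrightarrow> energy \<beta> u u' t \<le> energy \<beta> u u' s"
  using increment_le_of_derivative_le[OF energy_derivative, of s t 0] by simp

lemma continuous_on_energy: "continuous_on {0..} (energy \<beta> u u')"
  using energy_derivative by (intro DERIV_continuous_on) auto

lemma abs_velocity_le: "energy \<beta> u u' t \<le> 2 * e \<Longrightarrow> \<bar>u' t\<bar> \<le> 2 * sqrt e"
proof -
  assume "energy \<beta> u u' t \<le> 2 * e"
  moreover have "0 \<le> 1 / (\<beta> + 2) * \<bar>u t\<bar> powr (\<beta> + 2)" using \<beta> by simp
  ultimately have "(u' t)\<^sup>2 \<le> 4 * e" unfolding energy_def by simp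
  then have "\<bar>u' t\<bar> \<le> sqrt (4 * e)" by (rule real_le_rsqrt[of "\<bar>u' t\<bar>", simplified])
  then show ?thesis by (simp add: real_sqrt_mult)
qed

lemma abs_position_le:
  assumes "energy \<beta> u u' t \<le> 2 * e"
  shows "\<bar>u t\<bar> \<le> (2 * (\<beta> + 2) * e) powr (1 / (\<beta> + 2))"
proof -
  have "0 \<le> 1 / 2 * (u' t)\<^sup>2" by simp
  then have "1 / (\<beta> + 2) * \<bar>u t\<bar> powr (\<beta> + 2) \<le> 2 * e"
    using assms unfolding energy_def by linarith
  then have "\<bar>u t\<bar> powr (\<beta> + 2) \<le> 2 * (\<beta> + 2) * e"
    using \<beta> by (simp add: field_simps)
  then have "(\<bar>u t\<bar> powr (\<beta> + 2)) powr (1 / (\<beta> + 2)) \<le> (2 * (\<beta> + 2) * e) powr (1 / (\<beta> + 2))"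
    using \<beta> by (intro powr_mono2) auto
  then show ?thesis using \<beta> by (simp add: powr_powr)
qed

section \<open>The time needed to halve the energy\<close>

text \<open>
  The negative term of \<open>(u u')'\<close> is bounded with \<open>E \<ge> e\<close>, which costs another multiple of \<open>u'\<^sup>2\<close>
  and makes its coefficient \<open>\<kappa> = 1 + (\<beta> + 2) / 2\<close>.
  The thresholds are such that each of the two positive terms costs one of the \<open>\<beta> + 2\<close> copies of
  \<open>e\<close> that are available.
\<close>

lemma cross_term_derivative_le:
  assumes "0 < e" "e \<le> energy \<beta> u u' t" and M: "0 < M" "\<bar>u t\<bar> \<le> M"
  defines "\<kappa> \<equiv> (\<beta> + 4) / 2"
  shows "(u' t)\<^sup>2 - \<bar>u' t\<bar> powr \<alpha> * u' t * u t - \<bar>u t\<bar> powr (\<beta> + 2)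
    \<le> (\<kappa> * (e / \<kappa>) powr (- \<alpha> / 2) + M * (e / M) powr (- 1 / (\<alpha> + 1))) * \<bar>u' t\<bar> powr (\<alpha> + 2)
      - \<beta> * e"
proof -
  define D where "D = \<bar>u' t\<bar> powr (\<alpha> + 2)"
  have \<kappa>: "\<kappa> > 0" using \<beta> unfolding \<kappa>_def by simp
  have "\<bar>u' t\<bar> powr 2 \<le> ((e / \<kappa>) powr (1/2)) powr 2 + ((e / \<kappa>) powr (1/2)) powr (2 - (\<alpha> + 2)) * D"
    unfolding D_def using \<alpha> \<kappa> \<open>0 < e\<close> by (intro powr_le_threshold) auto
  then have "(u' t)\<^sup>2 \<le> e / \<kappa> + (e / \<kappa>) powr (- \<alpha> / 2) * D"
    using \<kappa> \<open>0 < e\<close> by (simp add: powr_powr)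
  then have "\<kappa> * (u' t)\<^sup>2 \<le> \<kappa> * (e / \<kappa> + (e / \<kappa>) powr (- \<alpha> / 2) * D)"
    using \<kappa> by (intro mult_left_mono) auto
  then have kin: "\<kappa> * (u' t)\<^sup>2 \<le> e + \<kappa> * (e / \<kappa>) powr (- \<alpha> / 2) * D"
    using \<kappa> by (simp add: algebra_simps)
  have "\<bar>u' t\<bar> powr (\<alpha> + 1) \<le> ((e / M) powr (1 / (\<alpha> + 1))) powr (\<alpha> + 1)
      + ((e / M) powr (1 / (\<alpha> + 1))) powr (\<alpha> + 1 - (\<alpha> + 2)) * D"
    unfolding D_def using \<alpha> M \<open>0 < e\<close> by (intro powr_le_threshold) auto
  also have "\<dots> = e / M + (e / M) powr (- 1 / (\<alpha> + 1)) * D"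
    using \<alpha> M \<open>0 < e\<close> by (simp add: powr_powr powr_minus_divide)
  finally have "M * \<bar>u' t\<bar> powr (\<alpha> + 1) \<le> M * (e / M + (e / M) powr (- 1 / (\<alpha> + 1)) * D)"
    using M by (intro mult_left_mono) auto
  then have damp: "M * \<bar>u' t\<bar> powr (\<alpha> + 1) \<le> e + M * (e / M) powr (- 1 / (\<alpha> + 1)) * D"
    using M by (simp add: algebra_simps)
  have "- (\<bar>u' t\<bar> powr \<alpha> * u' t * u t) \<le> \<bar>\<bar>u' t\<bar> powr \<alpha> * u' t * u t\<bar>" by linarith
  also have "\<dots> = \<bar>u' t\<bar> powr (\<alpha> + 1) * \<bar>u t\<bar>"
    by (cases "u' t = 0") (simp_all add: abs_mult powr_add)
  also have "\<dots> \<le> \<bar>u' t\<bar> powr (\<alpha> + 1) * M" using M by (intro mult_left_mono) auto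
  finally have cross: "- (\<bar>u' t\<bar> powr \<alpha> * u' t * u t) \<le> M * \<bar>u' t\<bar> powr (\<alpha> + 1)"
    by (simp add: mult.commute)
  have "(\<beta> + 2) * e \<le> (\<beta> + 2) * energy \<beta> u u' t" using assms \<beta> by (intro mult_left_mono) auto
  also have "\<dots> = (\<kappa> - 1) * (u' t)\<^sup>2 + \<bar>u t\<bar> powr (\<beta> + 2)"
    using \<beta> unfolding energy_def \<kappa>_def by (simp add: field_simps)
  finally have pot: "(\<beta> + 2) * e \<le> (\<kappa> - 1) * (u' t)\<^sup>2 + \<bar>u t\<bar> powr (\<beta> + 2)" .
  show ?thesis using kin damp cross pot unfolding D_def by (simp add: algebra_simps)
qed

text \<open>
  The integrated form of the previous estimate: \<open>M\<close> bounds \<open>\<bar>u\<bar>\<close> as long as the energy is at most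
  \<open>2 e\<close>, and adding \<open>K E\<close> to \<open>u u'\<close> cancels the multiple \<open>K\<close> of the dissipation.
\<close>

lemma halving_time_raw:
  assumes "0 \<le> s" "s \<le> t" and e: "0 < energy \<beta> u u' t" "e = energy \<beta> u u' t"
    and half: "energy \<beta> u u' s \<le> 2 * e"
  defines "\<kappa> \<equiv> (\<beta> + 4) / 2" and "M \<equiv> (2 * (\<beta> + 2) * e) powr (1 / (\<beta> + 2))"
  shows "\<beta> * e * (t - s)
    \<le> 4 * sqrt e * M + (\<kappa> * (e / \<kappa>) powr (- \<alpha> / 2) + M * (e / M) powr (- 1 / (\<alpha> + 1))) * e"
proof -
  define K where "K = \<kappa> * (e / \<kappa>) powr (- \<alpha> / 2) + M * (e / M) powr (- 1 / (\<alpha> + 1))"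
  have "e > 0" using e by simp
  have "M > 0" unfolding M_def using \<open>e > 0\<close> \<beta> by simp
  have "\<kappa> > 0" unfolding \<kappa>_def using \<beta> by simp
  have "K \<ge> 0" unfolding K_def using \<open>M > 0\<close> \<open>\<kappa> > 0\<close> by simp
  define \<Phi> where "\<Phi> = (\<lambda>t. u t * u' t + K * energy \<beta> u u' t)"
  have deriv: "(\<Phi> has_real_derivative ((u' t)\<^sup>2 - \<bar>u' t\<bar> powr \<alpha> * u' t * u t - \<bar>u t\<bar> powr (\<beta> + 2))
      + K * - (\<bar>u' t\<bar> powr (\<alpha> + 2))) (at t within {0..})" if "t \<ge> 0" for t
    unfolding \<Phi>_def
    by (intro DERIV_add DERIV_cmult cross_term_derivative energy_derivative that)
  have rate: "((u' r)\<^sup>2 - \<bar>u' r\<bar> powr \<alpha> * u' r * u r - \<bar>u r\<bar> powr (\<beta> + 2))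
      + K * - (\<bar>u' r\<bar> powr (\<alpha> + 2)) \<le> - (\<beta> * e)" if "s \<le> r" "r \<le> t" for r
  proof -
    have "e \<le> energy \<beta> u u' r" "energy \<beta> u u' r \<le> 2 * e"
      using energy_antimono[of r t] energy_antimono[of s r] that half e \<open>0 \<le> s\<close> by auto
    then have "\<bar>u r\<bar> \<le> M" unfolding M_def by (intro abs_position_le)
    from cross_term_derivative_le[OF \<open>e > 0\<close> \<open>e \<le> energy \<beta> u u' r\<close> \<open>M > 0\<close> this]
    show ?thesis unfolding K_def \<kappa>_def by simp
  qed
  have "\<Phi> t - \<Phi> s \<le> - (\<beta> * e) * (t - s)"
    by (rule increment_le_of_derivative_le[OF deriv assms(1,2) rate])
  then have decay: "\<beta> * e * (t - s) \<le> u s * u' s - u t * u' t + K * (energy \<beta> u u' s - energy \<beta> u u' t)"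
    unfolding \<Phi>_def by (simp add: algebra_simps)
  have bound: "\<bar>u r * u' r\<bar> \<le> 2 * sqrt e * M" if "energy \<beta> u u' r \<le> 2 * e" for r
    using mult_mono[OF abs_position_le[OF that] abs_velocity_le[OF that]] \<open>M > 0\<close>
    unfolding M_def by (simp add: abs_mult mult_ac)
  have "\<bar>u s * u' s\<bar> \<le> 2 * sqrt e * M" "\<bar>u t * u' t\<bar> \<le> 2 * sqrt e * M"
    by (rule bound; use half e in linarith)+
  with decay have "\<beta> * e * (t - s) \<le> 4 * sqrt e * M + K * (energy \<beta> u u' s - energy \<beta> u u' t)"
    by linarith
  also have "\<dots> \<le> 4 * sqrt e * M + K * e"
    using half e \<open>K \<ge> 0\<close> by (intro add_left_mono mult_left_mono) auto
  finally show ?thesis unfolding K_def .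
qed

end


definition halving_bound :: "real \<Rightarrow> real \<Rightarrow> real \<Rightarrow> real" where
  "halving_bound \<alpha> \<beta> e = e powr (- \<alpha> / 2) + e powr (- ((\<beta> - \<alpha>) / ((\<alpha> + 1) * (\<beta> + 2))))"

text \<open>
  The change of the cross term contributes the third power \<open>- \<beta> / (2 (\<beta> + 2))\<close> of \<open>e\<close>.  It always
  lies between the two powers in the bound, all three being equal when \<open>\<beta> = \<alpha> (\<beta> + 2)\<close>.
\<close>

lemma cross_term_le_halving_bound:
  assumes "0 < \<alpha>" "\<alpha> < \<beta>" "0 < e"
  shows "e powr (1 / (\<beta> + 2) - 1 / 2) \<le> halving_bound \<alpha> \<beta> e"
  unfolding halving_bound_def
proof (rule powr_between_le_add[OF \<open>0 < e\<close>])
  define q where "q = (\<beta> - \<alpha>) / ((\<alpha> + 1) * (\<beta> + 2))"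
  have p: "1 / (\<beta> + 2) - 1 / 2 = - (\<beta> / (2 * (\<beta> + 2)))"
    using assms by (simp add: field_simps)
  have 1: "\<alpha> / 2 \<le> \<beta> / (2 * (\<beta> + 2)) \<longleftrightarrow> \<alpha> * (\<beta> + 2) \<le> \<beta>"
    using assms by (simp add: field_simps, intro iffI; linarith)
  have "\<beta> / (2 * (\<beta> + 2)) = \<beta> * (\<alpha> + 1) / (2 * (\<alpha> + 1) * (\<beta> + 2))"
    and "q = 2 * (\<beta> - \<alpha>) / (2 * (\<alpha> + 1) * (\<beta> + 2))"
    using assms unfolding q_def by (simp_all add: divide_simps) (simp_all add: algebra_simps)
  moreover have "0 < 2 * (\<alpha> + 1) * (\<beta> + 2)" using assms by simp
  ultimately have 2: "\<beta> / (2 * (\<beta> + 2)) \<le> q \<longleftrightarrow> \<alpha> * (\<beta> + 2) \<le> \<beta>"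
    and 3: "q \<le> \<beta> / (2 * (\<beta> + 2)) \<longleftrightarrow> \<beta> \<le> \<alpha> * (\<beta> + 2)"
    by (simp_all add: divide_le_cancel algebra_simps)
  show "- \<alpha> / 2 \<le> 1 / (\<beta> + 2) - 1 / 2 \<and> 1 / (\<beta> + 2) - 1 / 2 \<le> - ((\<beta> - \<alpha>) / ((\<alpha> + 1) * (\<beta> + 2)))
      \<or> - ((\<beta> - \<alpha>) / ((\<alpha> + 1) * (\<beta> + 2))) \<le> 1 / (\<beta> + 2) - 1 / 2 \<and> 1 / (\<beta> + 2) - 1 / 2 \<le> - \<alpha> / 2"
    unfolding p q_def[symmetric] using 1 2 3 by linarith
qed

lemma halving_time:
  assumes "0 < \<alpha>" "\<alpha> < \<beta>"
  obtains A where "A > 0"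
    and "\<And>u u' u'' s t. is_solution \<alpha> \<beta> u u' u'' \<Longrightarrow> 0 \<le> s \<Longrightarrow> s \<le> t \<Longrightarrow> 0 < energy \<beta> u u' t
      \<Longrightarrow> energy \<beta> u u' s \<le> 2 * energy \<beta> u u' t
      \<Longrightarrow> t - s \<le> A * halving_bound \<alpha> \<beta> (energy \<beta> u u' t)"
proof
  define \<kappa> where "\<kappa> = (\<beta> + 4) / 2"
  define c where "c = (2 * (\<beta> + 2)) powr (1 / (\<beta> + 2))"
  define A where "A = (4 * c + \<kappa> * \<kappa> powr (\<alpha> / 2) + c * c powr (1 / (\<alpha> + 1))) / \<beta>"
  have "\<kappa> > 0" "c > 0" using assms unfolding \<kappa>_def c_def by auto
  then show "A > 0" using assms unfolding A_def by (auto intro!: divide_pos_pos add_pos_pos)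
  fix u u' u'' and s t :: real
  assume sol: "is_solution \<alpha> \<beta> u u' u''" and st: "0 \<le> s" "s \<le> t"
    and pos: "0 < energy \<beta> u u' t" and half: "energy \<beta> u u' s \<le> 2 * energy \<beta> u u' t"
  define e where "e = energy \<beta> u u' t"
  define R where "R = halving_bound \<alpha> \<beta> e"
  define M where "M = c * e powr (1 / (\<beta> + 2))"
  have "e > 0" using pos e_def by simp
  have "M > 0" using \<open>c > 0\<close> \<open>e > 0\<close> unfolding M_def by simp
  have R: "e powr (- \<alpha> / 2) \<le> R" "e powr (- ((\<beta> - \<alpha>) / ((\<alpha> + 1) * (\<beta> + 2)))) \<le> R"
    unfolding R_def halving_bound_def by simp_all
  have M_alt: "(2 * (\<beta> + 2) * e) powr (1 / (\<beta> + 2)) = M"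
    using assms \<open>e > 0\<close> unfolding M_def c_def by (simp add: powr_mult)
  have "sqrt e * e powr (1 / (\<beta> + 2)) = e powr (1 / 2 + 1 / (\<beta> + 2))"
    using \<open>e > 0\<close> by (simp add: powr_add powr_half_sqrt)
  also have "1 / 2 + 1 / (\<beta> + 2) = (1 / (\<beta> + 2) - 1 / 2) + 1" by simp
  also have "e powr \<dots> = e powr (1 / (\<beta> + 2) - 1 / 2) * e"
    using \<open>e > 0\<close> by (subst powr_add) simp
  also have "\<dots> \<le> R * e"
    unfolding R_def using \<open>e > 0\<close> assms by (intro mult_right_mono cross_term_le_halving_bound) auto
  finally have "4 * c * (sqrt e * e powr (1 / (\<beta> + 2))) \<le> 4 * c * (R * e)"
    using \<open>c > 0\<close> by (intro mult_left_mono) auto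
  then have t1: "4 * sqrt e * M \<le> 4 * c * R * e" unfolding M_def by (simp add: mult_ac)
  have "\<kappa> * (e / \<kappa>) powr (- \<alpha> / 2) = \<kappa> * \<kappa> powr (\<alpha> / 2) * e powr (- \<alpha> / 2)"
    using \<open>e > 0\<close> \<open>\<kappa> > 0\<close> by (simp add: powr_divide powr_minus_divide)
  also have "\<dots> \<le> \<kappa> * \<kappa> powr (\<alpha> / 2) * R" using R \<open>\<kappa> > 0\<close> by (intro mult_left_mono) auto
  finally have t2: "\<kappa> * (e / \<kappa>) powr (- \<alpha> / 2) \<le> \<kappa> * \<kappa> powr (\<alpha> / 2) * R" .
  have "1 / y + 1 / y * (1 / x) + - (1 / x) = - ((y - x - 1) / (x * y))"
    if "x > 0" "y > 0" for x y :: real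
    using that by (simp add: field_simps)
  from this[of "\<alpha> + 1" "\<beta> + 2"]
  have "1 / (\<beta> + 2) + 1 / (\<beta> + 2) * (1 / (\<alpha> + 1)) + - (1 / (\<alpha> + 1))
      = - ((\<beta> - \<alpha>) / ((\<alpha> + 1) * (\<beta> + 2)))"
    using assms by simp
  moreover have "M * (e / M) powr (- 1 / (\<alpha> + 1))
      = c * c powr (1 / (\<alpha> + 1))
        * e powr (1 / (\<beta> + 2) + 1 / (\<beta> + 2) * (1 / (\<alpha> + 1)) + - (1 / (\<alpha> + 1)))"
    unfolding powr_add M_def using \<open>e > 0\<close> \<open>c > 0\<close>
    by (simp add: powr_divide powr_mult powr_minus_divide powr_powr)
  ultimately have "M * (e / M) powr (- 1 / (\<alpha> + 1))
      = c * c powr (1 / (\<alpha> + 1)) * e powr (- ((\<beta> - \<alpha>) / ((\<alpha> + 1) * (\<beta> + 2))))" by simp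
  also have "\<dots> \<le> c * c powr (1 / (\<alpha> + 1)) * R" using R \<open>c > 0\<close> by (intro mult_left_mono) auto
  finally have t3: "M * (e / M) powr (- 1 / (\<alpha> + 1)) \<le> c * c powr (1 / (\<alpha> + 1)) * R" .
  have "\<beta> * e * (t - s)
      \<le> 4 * sqrt e * M + (\<kappa> * (e / \<kappa>) powr (- \<alpha> / 2) + M * (e / M) powr (- 1 / (\<alpha> + 1))) * e"
    using halving_time_raw[OF _ _ sol st pos e_def half[folded e_def]] assms
    unfolding M_alt \<kappa>_def by simp
  also have "\<dots> \<le> 4 * c * R * e + (\<kappa> * \<kappa> powr (\<alpha> / 2) * R + c * c powr (1 / (\<alpha> + 1)) * R) * e"
    using t1 t2 t3 \<open>e > 0\<close> by (intro add_mono mult_right_mono) auto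
  also have "\<dots> = \<beta> * e * (A * R)" using assms unfolding A_def by (simp add: field_simps)
  finally have "t - s \<le> A * R"
    by (rule mult_left_le_imp_le) (use \<open>e > 0\<close> assms in simp)
  then show "t - s \<le> A * halving_bound \<alpha> \<beta> (energy \<beta> u u' t)"
    unfolding R_def e_def .
qed

section \<open>Summing the halving times\<close>

lemma halving_bound_double:
  assumes "0 < \<alpha>" "\<alpha> < \<beta>"
  obtains r where "0 \<le> r" "r < 1" "\<And>e. 0 < e \<Longrightarrow> halving_bound \<alpha> \<beta> (2 * e) \<le> r * halving_bound \<alpha> \<beta> e"
proof
  define q where "q = (\<beta> - \<alpha>) / ((\<alpha> + 1) * (\<beta> + 2))"
  have "q > 0" using assms unfolding q_def by simp
  define r where "r = max (2 powr (- \<alpha> / 2)) (2 powr (- q))"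
  show "0 \<le> r" unfolding r_def by (simp add: le_max_iff_disj)
  show "r < 1" using assms \<open>q > 0\<close> unfolding r_def by (simp add: powr_less_one)
  fix e :: real assume "0 < e"
  then have "halving_bound \<alpha> \<beta> (2 * e) = 2 powr (- \<alpha> / 2) * e powr (- \<alpha> / 2) + 2 powr (- q) * e powr (- q)"
    unfolding halving_bound_def q_def by (simp only: powr_mult)
  also have "\<dots> \<le> r * e powr (- \<alpha> / 2) + r * e powr (- q)"
    unfolding r_def by (intro add_mono mult_right_mono) auto
  finally show "halving_bound \<alpha> \<beta> (2 * e) \<le> r * halving_bound \<alpha> \<beta> e"
    unfolding halving_bound_def q_def by (simp add: distrib_left)
qed

text \<open>
  The constant is the sum \<open>A / (1 - r)\<close> of the geometric series: to descend from \<open>2^(n+1) e\<close> to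
  \<open>e\<close>, the solution descends to \<open>2 e\<close> in a time at most \<open>r\<close> times the bound claimed at \<open>e\<close>, and the
  last halving takes what the factor \<open>1 - r\<close> leaves.
\<close>

lemma time_le_halving_bound:
  assumes "0 < \<alpha>" "\<alpha> < \<beta>"
  obtains B where "B > 0"
    and "\<And>u u' u'' t. is_solution \<alpha> \<beta> u u' u'' \<Longrightarrow> 0 \<le> t \<Longrightarrow> 0 < energy \<beta> u u' t
      \<Longrightarrow> t \<le> B * halving_bound \<alpha> \<beta> (energy \<beta> u u' t)"
proof -
  obtain A where "A > 0" and A: "\<And>u u' u'' s t. is_solution \<alpha> \<beta> u u' u'' \<Longrightarrow> 0 \<le> s \<Longrightarrow> s \<le> t
      \<Longrightarrow> 0 < energy \<beta> u u' t \<Longrightarrow> energy \<beta> u u' s \<le> 2 * energy \<beta> u u' t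
      \<Longrightarrow> t - s \<le> A * halving_bound \<alpha> \<beta> (energy \<beta> u u' t)"
    using halving_time[OF assms] by blast
  obtain r where "0 \<le> r" "r < 1"
    and r: "\<And>e. 0 < e \<Longrightarrow> halving_bound \<alpha> \<beta> (2 * e) \<le> r * halving_bound \<alpha> \<beta> e"
    using halving_bound_double[OF assms] by blast
  define B where "B = A / (1 - r)"
  have "B > 0" using \<open>A > 0\<close> \<open>r < 1\<close> unfolding B_def by simp
  have B: "B * r + A = B" using \<open>r < 1\<close> unfolding B_def by (simp add: field_simps)
  have "A \<le> B" using B \<open>B > 0\<close> \<open>0 \<le> r\<close> by (smt (verit) mult_nonneg_nonneg)
  have "t \<le> B * halving_bound \<alpha> \<beta> (energy \<beta> u u' t)"
    if sol: "is_solution \<alpha> \<beta> u u' u''" and "0 \<le> t" "0 < energy \<beta> u u' t" for u u' u'' t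
  proof -
    have \<beta>: "0 < \<beta>" using assms by simp
    have single: "t \<le> m + A * halving_bound \<alpha> \<beta> (energy \<beta> u u' t)"
      if "0 \<le> m" "m \<le> t" "0 < energy \<beta> u u' t" "energy \<beta> u u' m \<le> 2 * energy \<beta> u u' t" for m t
      using A[OF sol that] by simp
    have short: "t \<le> B * halving_bound \<alpha> \<beta> (energy \<beta> u u' t)"
      if "0 \<le> t" "0 < energy \<beta> u u' t" "energy \<beta> u u' 0 \<le> 2 * energy \<beta> u u' t" for t
    proof -
      have "t \<le> A * halving_bound \<alpha> \<beta> (energy \<beta> u u' t)"
        using single[of 0 t] that by simp
      also have "\<dots> \<le> B * halving_bound \<alpha> \<beta> (energy \<beta> u u' t)"
        using \<open>A \<le> B\<close> by (intro mult_right_mono) (auto simp: halving_bound_def)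
      finally show ?thesis .
    qed
    have descent: "t \<le> B * halving_bound \<alpha> \<beta> (energy \<beta> u u' t)"
      if "0 \<le> t" "0 < energy \<beta> u u' t" "energy \<beta> u u' 0 \<le> 2 ^ n * energy \<beta> u u' t" for n t
      using that
    proof (induction n arbitrary: t)
      case 0
      then show ?case using short[of t] by simp
    next
      case (Suc n)
      show ?case
      proof (cases "energy \<beta> u u' 0 \<le> 2 * energy \<beta> u u' t")
        case True
        then show ?thesis using short[of t] Suc.prems by simp
      next
        case False
        have "continuous_on {0..t} (energy \<beta> u u')"
          using continuous_on_energy[OF assms(1) \<beta> sol] by (rule continuous_on_subset) auto
        then obtain m where m: "0 \<le> m" "m \<le> t" "energy \<beta> u u' m = 2 * energy \<beta> u u' t"
          using IVT2'[of "energy \<beta> u u'" t "2 * energy \<beta> u u' t" 0] False Suc.prems by auto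
        have "m \<le> B * halving_bound \<alpha> \<beta> (2 * energy \<beta> u u' t)"
          using Suc.IH[of m] Suc.prems m by simp
        also have "\<dots> \<le> B * (r * halving_bound \<alpha> \<beta> (energy \<beta> u u' t))"
          using r Suc.prems \<open>B > 0\<close> by (intro mult_left_mono) auto
        finally have "t \<le> (B * r + A) * halving_bound \<alpha> \<beta> (energy \<beta> u u' t)"
          using single[of m t] m Suc.prems by (simp add: algebra_simps)
        then show ?thesis unfolding B .
      qed
    qed
    obtain n :: nat where "energy \<beta> u u' 0 / energy \<beta> u u' t < 2 ^ n"
      using real_arch_pow[of 2] by auto
    then show ?thesis
      using descent[of t n] that by (simp add: field_simps)
  qed
  with \<open>B > 0\<close> show ?thesis using that by blast
qed

text \<open>
  One of the two powers in the bound is at least half of it, and this power is inverted.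
\<close>

lemma le_of_le_halving_bound:
  assumes "0 < \<alpha>" "\<alpha> < \<beta>" "0 < B" "0 < t" "0 < e" "t \<le> B * halving_bound \<alpha> \<beta> e"
  defines "a \<equiv> 2 / \<alpha>" and "b \<equiv> (\<alpha> + 1) * (\<beta> + 2) / (\<beta> - \<alpha>)"
  shows "e \<le> max ((2 * B) powr a) ((2 * B) powr b) * max (t powr (- a)) (t powr (- b))"
proof -
  have invert: "e \<le> (2 * B) powr p * t powr (- p)" if "p > 0" "t \<le> 2 * B * e powr (- 1 / p)" for p
  proof -
    have "t powr p \<le> (2 * B * e powr (- 1 / p)) powr p"
      using that assms by (intro powr_mono2) auto
    also have "\<dots> = (2 * B) powr p * (e powr (- 1 / p)) powr p"
      by (rule powr_mult)
    also have "(e powr (- 1 / p)) powr p = e powr - 1"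
      using that unfolding powr_powr by simp
    finally have "t powr p \<le> (2 * B) powr p / e"
      using assms by (simp add: powr_minus_divide)
    then show ?thesis using assms by (simp add: field_simps powr_minus_divide)
  qed
  have "\<alpha> / 2 = 1 / a" "(\<beta> - \<alpha>) / ((\<alpha> + 1) * (\<beta> + 2)) = 1 / b"
    unfolding a_def b_def by simp_all
  then have exps: "- \<alpha> / 2 = - 1 / a" "- ((\<beta> - \<alpha>) / ((\<alpha> + 1) * (\<beta> + 2))) = - 1 / b"
    by linarith+
  have "a > 0" "b > 0" using assms unfolding a_def b_def by simp_all
  have "t \<le> B * (e powr (- 1 / a) + e powr (- 1 / b))"
    using assms(6) unfolding halving_bound_def exps .
  also have "\<dots> \<le> B * (2 * max (e powr (- 1 / a)) (e powr (- 1 / b)))"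
    using \<open>0 < B\<close> by (intro mult_left_mono) auto
  finally have "t \<le> 2 * B * e powr (- 1 / a) \<or> t \<le> 2 * B * e powr (- 1 / b)"
    by (auto simp: max_def split: if_splits)
  then have "e \<le> (2 * B) powr a * t powr (- a) \<or> e \<le> (2 * B) powr b * t powr (- b)"
    using invert \<open>a > 0\<close> \<open>b > 0\<close> by blast
  moreover have "(2 * B) powr a * t powr (- a)
      \<le> max ((2 * B) powr a) ((2 * B) powr b) * max (t powr (- a)) (t powr (- b))"
    "(2 * B) powr b * t powr (- b)
      \<le> max ((2 * B) powr a) ((2 * B) powr b) * max (t powr (- a)) (t powr (- b))"
    by (intro mult_mono; simp add: le_max_iff_disj)+
  ultimately show ?thesis by linarith
qed

section \<open>Decay of the energy\<close>

theorem theorem3p1: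
  fixes \<alpha> \<beta> :: real
  assumes "0 < \<alpha>" and "\<alpha> < \<beta>"
  shows "\<exists>C::real. \<forall>u u' u''. is_solution \<alpha> \<beta> u u' u'' \<longrightarrow>
           (\<forall>t>0. energy \<beta> u u' t \<le>
              C * max (t powr (- (2 / \<alpha>)))
                      (t powr (- ((\<alpha> + 1) * (\<beta> + 2) / (\<beta> - \<alpha>)))))"
proof -
  define a where "a = 2 / \<alpha>"
  define b where "b = (\<alpha> + 1) * (\<beta> + 2) / (\<beta> - \<alpha>)"
  obtain B where "B > 0" and B: "\<And>u u' u'' t. is_solution \<alpha> \<beta> u u' u'' \<Longrightarrow> 0 \<le> t
      \<Longrightarrow> 0 < energy \<beta> u u' t \<Longrightarrow> t \<le> B * halving_bound \<alpha> \<beta> (energy \<beta> u u' t)"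
    using time_le_halving_bound[OF assms] by blast
  have "energy \<beta> u u' t
      \<le> max ((2 * B) powr a) ((2 * B) powr b) * max (t powr (- a)) (t powr (- b))"
    if "is_solution \<alpha> \<beta> u u' u''" "t > 0" for u u' u'' t
  proof (cases "energy \<beta> u u' t > 0")
    case True
    then show ?thesis
      unfolding a_def b_def
      using le_of_le_halving_bound[OF assms \<open>B > 0\<close> \<open>t > 0\<close> True] B[OF that(1) _ True] that(2) by simp
  next
    case False
    moreover have "0 \<le> max ((2 * B) powr a) ((2 * B) powr b) * max (t powr (- a)) (t powr (- b))"
      by (intro mult_nonneg_nonneg) (simp_all add: le_max_iff_disj)
    ultimately show ?thesis by linarith
  qed
  then show ?thesis unfolding a_def b_def by blast
qed

end
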